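(* Suppose that for all $Y\in\mathcal Y^d$, $R(Y)$ is a closed upper set and $R_0(Y)$ equals the topological boundary $\partial R(Y)$. Assume that $R_0$ is selectively identifiable with an oriented strict selective $\mathcal M^d$-identification function $V_{R_0}\colon\mathbb R^d\times\mathbb R^d\to\mathbb R$. Let $w\in\mathbb R^d_{++}$ and define $V_{EAR_w}\colon\mathbb R^d\times\mathbb R^d\to\mathbb R^{w^\perp}$ by $$V_{EAR_w}(k,y)(x)=V_{R_0}(k+x,y),\qquad x\in w^\perp,\ (k,y)\in\mathbb R^d\times\mathbb R^d.$$ Then $V_{EAR_w}$ is a strict selective $\mathcal M^d$-identification function for $EAR_w$ in the sense that for any $F\in\mathcal M^d$ and any $k\in\mathbb R^d$ $$k\in EAR_w(F)\iff\Big(\bar V_{EAR_w}(k,F)(x)\le0\ \text{ for all }x\in w^\perp\ \text{ and }\ \bar V_{EAR_w}(k,F)(0)=0\Big).$$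
   Context: Setting: $(\Omega,\mathfrak F,\mathbb P)$ is an atomless probability space, $d\ge1$, $\mathcal Y^d\subseteq L^0(\Omega;\mathbb R^d)$ is a class of random vectors closed under translation by constants $k\in\mathbb R^d$. $\Lambda\colon\mathbb R^d\to\mathbb R$ is an aggregation function, i.e. non-decreasing for the componentwise order. $\mathcal Y\subseteq L^0(\Omega;\mathbb R)$ contains $\Lambda(Y)$ for all $Y\in\mathcal Y^d$ and is closed under translation by constants. $\mathcal M^d$ and $\mathcal M$ are the classes of distributions of elements of $\mathcal Y^d$ and $\mathcal Y$. $\rho\colon\mathcal Y\to\mathbb R$ is a law-invariant scalar risk measure that is cash-invariant ($\rho(X+m)=\rho(X)-m$) and monotone ($X\ge Z$ a.s. implies $\rho(X)\le\rho(Z)$). Define $R(Y)=\{k\in\mathbb R^d:\rho(\Lambda(Y+k))\le0\}$ and $R_0(Y)=\{k\in\mathbb R^d:\rho(\Lambda(Y+k))=0\}$; these are law-invariant and we write $R(F_Y)=R(Y)$, $R_0(F_Y)=R_0(Y)$. An upper set is a set $B\subseteq\mathbb R^d$ with $B=B+\mathbb R^d_+$. $\mathbb R^d_{++}=\{x\in\mathbb R^d: x_1,\dots,x_d>0\}$; $w^\perp=\{x\in\mathbb R^d: w^\top x=0\}$; $\mathbb R^{w^\perp}$ is the set of functions $w^\perp\to\mathbb R$. The efficient cash-invariant allocation rule with price vector $w$ is $EAR_w(Y)=\operatorname{arg\,min}_{k\in R(Y)}w^\top k$, the (possibly empty) set of minimisers, and $EAR_w(F_Y)=EAR_w(Y)$.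 Bars denote expectation: $\bar V(k,F)=\int V(k,y)\,dF(y)$, pointwise for function-valued $V$, i.e. $\bar V_{EAR_w}(k,F)(x)=\int V_{R_0}(k+x,y)\,dF(y)$; these integrals are tacitly assumed to exist. $V_{R_0}$ is a strict selective $\mathcal M^d$-identification function for $R_0$ if $\bar V_{R_0}(k,F)=0\iff k\in R_0(F)$ for all $k\in\mathbb R^d$, $F\in\mathcal M^d$; it is oriented if in addition $\bar V_{R_0}(k,F)<0$ for $k\notin R(F)$ and $\bar V_{R_0}(k,F)>0$ for $k\in R(F)\setminus R_0(F)$. *)

theory Defs
  imports "HOL-Probability.Probability"
begin

section \<open>Laws and law-invariant functionals\<close>

definition atomless :: "'w measure \<Rightarrow> bool" where
  "atomless M \<longleftrightarrow> (\<forall>A\<in>sets M. emeasure M A > 0 \<longrightarrow>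
     (\<exists>B\<in>sets M. B \<subseteq> A \<and> 0 < emeasure M B \<and> emeasure M B < emeasure M A))"

definition law :: "'w measure \<Rightarrow> ('w \<Rightarrow> 'a::topological_space) \<Rightarrow> 'a measure" where
  "law M Y = distr M borel Y"

definition law_invariant ::
  "'w measure \<Rightarrow> ('w \<Rightarrow> 'a::topological_space) set \<Rightarrow> (('w \<Rightarrow> 'a) \<Rightarrow> 'b) \<Rightarrow> bool" where
  "law_invariant M \<Y> T \<longleftrightarrow> (\<forall>Y\<in>\<Y>. \<forall>Z\<in>\<Y>. law M Y = law M Z \<longrightarrow> T Y = T Z)"

text \<open>The functional on laws induced by a law-invariant functional \<open>T\<close>, written \<open>T(F\<^sub>Y) = T(Y)\<close>
  on paper; it is meaningful on \<open>law M ` \<Y>\<close>, see \<open>on_laws_law\<close>.\<close>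

definition on_laws ::
  "'w measure \<Rightarrow> ('w \<Rightarrow> 'a::topological_space) set \<Rightarrow> (('w \<Rightarrow> 'a) \<Rightarrow> 'b) \<Rightarrow> 'a measure \<Rightarrow> 'b" where
  "on_laws M \<Y> T F = T (SOME Y. Y \<in> \<Y> \<and> law M Y = F)"

lemma on_laws_law:
  assumes "law_invariant M \<Y> T" "Y \<in> \<Y>"
  shows "on_laws M \<Y> T (law M Y) = T Y"
proof -
  have "(SOME Z. Z \<in> \<Y> \<and> law M Z = law M Y) \<in> \<Y> \<and>
        law M (SOME Z. Z \<in> \<Y> \<and> law M Z = law M Y) = law M Y"
    by (rule someI[of _ Y]) (use assms in simp)
  then show ?thesis
    using assms unfolding law_invariant_def on_laws_def by blast
qed

section \<open>Systemic risk measures\<close>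

definition R ::
  "(('w \<Rightarrow> real) \<Rightarrow> real) \<Rightarrow> (real^'d \<Rightarrow> real) \<Rightarrow> ('w \<Rightarrow> real^'d) \<Rightarrow> (real^'d) set" where
  "R \<rho> \<Lambda> Y = {k. \<rho> (\<lambda>\<omega>. \<Lambda> (Y \<omega> + k)) \<le> 0}"

definition R0 ::
  "(('w \<Rightarrow> real) \<Rightarrow> real) \<Rightarrow> (real^'d \<Rightarrow> real) \<Rightarrow> ('w \<Rightarrow> real^'d) \<Rightarrow> (real^'d) set" where
  "R0 \<rho> \<Lambda> Y = {k. \<rho> (\<lambda>\<omega>. \<Lambda> (Y \<omega> + k)) = 0}"

definition EAR ::
  "(('w \<Rightarrow> real) \<Rightarrow> real) \<Rightarrow> (real^'d \<Rightarrow> real) \<Rightarrow> real^'d \<Rightarrow> ('w \<Rightarrow> real^'d) \<Rightarrow> (real^'d) set" where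
  "EAR \<rho> \<Lambda> w Y = {k. is_arg_min (\<lambda>k. w \<bullet> k) (\<lambda>k. k \<in> R \<rho> \<Lambda> Y) k}"

text \<open>Elements of \<open>L\<^sup>0\<close> are represented by measurable functions rather than by classes modulo
  almost sure equality.  The order on \<open>real^'d\<close> is componentwise.  A componentwise monotone
  \<open>\<Lambda>\<close> need not be Borel measurable, so measurability of \<open>\<Lambda>(Y)\<close> comes from
  \<open>aggregate\<close>, and the law-invariance of \<open>R\<close> and \<open>R0\<close> does not follow from that of \<open>\<rho>\<close>
  but is part of the setting.\<close>

locale systemic_risk = prob_space M
  for M :: "'w measure" +
  fixes \<Y>d :: "('w \<Rightarrow> real^'d) set"
    and \<Y> :: "('w \<Rightarrow> real) set"
    and \<Lambda> :: "real^'d \<Rightarrow> real"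
    and \<rho> :: "('w \<Rightarrow> real) \<Rightarrow> real"
  assumes atomless: "atomless M"
    and \<Y>d_measurable: "\<Y>d \<subseteq> borel_measurable M"
    and \<Y>d_translation: "\<And>Y k. Y \<in> \<Y>d \<Longrightarrow> (\<lambda>\<omega>. Y \<omega> + k) \<in> \<Y>d"
    and \<Lambda>_mono: "mono \<Lambda>"
    and \<Y>_measurable: "\<Y> \<subseteq> borel_measurable M"
    and aggregate: "\<And>Y. Y \<in> \<Y>d \<Longrightarrow> (\<lambda>\<omega>. \<Lambda> (Y \<omega>)) \<in> \<Y>"
    and \<Y>_translation: "\<And>X m. X \<in> \<Y> \<Longrightarrow> (\<lambda>\<omega>. X \<omega> + m) \<in> \<Y>"
    and \<rho>_law_invariant: "law_invariant M \<Y> \<rho>"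
    and \<rho>_cash_invariant: "\<And>X m. X \<in> \<Y> \<Longrightarrow> \<rho> (\<lambda>\<omega>. X \<omega> + m) = \<rho> X - m"
    and \<rho>_mono: "\<And>X Z. X \<in> \<Y> \<Longrightarrow> Z \<in> \<Y> \<Longrightarrow> (AE \<omega> in M. X \<omega> \<ge> Z \<omega>) \<Longrightarrow> \<rho> X \<le> \<rho> Z"
    and R_law_invariant: "law_invariant M \<Y>d (R \<rho> \<Lambda>)"
    and R0_law_invariant: "law_invariant M \<Y>d (R0 \<rho> \<Lambda>)"

definition upper_set :: "(real^'d) set \<Rightarrow> bool" where
  "upper_set B \<longleftrightarrow> B = {b + x | b x. b \<in> B \<and> 0 \<le> x}"

section \<open>Selective identification functions\<close>

definition expected ::
  "('k \<Rightarrow> 'a \<Rightarrow> real) \<Rightarrow> 'k \<Rightarrow> 'a measure \<Rightarrow> real" where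
  "expected V k F = (\<integral>y. V k y \<partial>F)"

definition expected_pointwise ::
  "('k \<Rightarrow> 'a \<Rightarrow> 'x \<Rightarrow> real) \<Rightarrow> 'k \<Rightarrow> 'a measure \<Rightarrow> 'x \<Rightarrow> real" where
  "expected_pointwise V k F = (\<lambda>x. expected (\<lambda>k y. V k y x) k F)"

text \<open>The Bochner integral is \<open>0\<close> for non-integrable functions, hence the
  integrability clause.\<close>

definition strict_selective_identification ::
  "'a measure set \<Rightarrow> ('a measure \<Rightarrow> 'k set) \<Rightarrow> ('k \<Rightarrow> 'a \<Rightarrow> real) \<Rightarrow> bool" where
  "strict_selective_identification \<M> T V \<longleftrightarrow>
     (\<forall>F\<in>\<M>. \<forall>k. integrable F (V k) \<and> (expected V k F = 0 \<longleftrightarrow> k \<in> T F))"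

definition oriented_strict_selective_identification ::
  "'a measure set \<Rightarrow> ('a measure \<Rightarrow> 'k set) \<Rightarrow> ('a measure \<Rightarrow> 'k set) \<Rightarrow>
     ('k \<Rightarrow> 'a \<Rightarrow> real) \<Rightarrow> bool" where
  "oriented_strict_selective_identification \<M> S S0 V \<longleftrightarrow>
     strict_selective_identification \<M> S0 V \<and>
     (\<forall>F\<in>\<M>. \<forall>k. (k \<notin> S F \<longrightarrow> expected V k F < 0) \<and>
                   (k \<in> S F - S0 F \<longrightarrow> expected V k F > 0))"

definition perp :: "real^'d \<Rightarrow> (real^'d) set" where
  "perp w = {x. w \<bullet> x = 0}"

text \<open>Functions on \<open>perp w\<close> are represented as extensional functions on \<open>real^'d\<close>.\<close>

definition V_EAR ::
  "real^'d \<Rightarrow> (real^'d \<Rightarrow> real^'d \<Rightarrow> real) \<Rightarrow> real^'d \<Rightarrow> real^'d \<Rightarrow> (real^'d \<Rightarrow> real)" where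
  "V_EAR w V k y = (\<lambda>x\<in>perp w. V (k + x) y)"

end

theory Submission
  imports Defs
begin

text \<open>Since \<open>R\<close> is closed and \<open>R0\<close> is its boundary, the orientation of \<open>V_R0\<close> makes its
  expectation positive exactly on the interior of \<open>R\<close>.  The right-hand side therefore says that
  \<open>k\<close> is a boundary point of \<open>R\<close> and that the hyperplane \<open>k + perp w\<close> misses the interior of \<open>R\<close>.
  A nonconstant linear functional has no minimiser in the interior, which gives necessity.
  Conversely, a cheaper point \<open>k'\<close> of \<open>R\<close> could be shifted by a strictly positive multiple
  of \<open>(1, \<dots>, 1)\<close> onto this hyperplane, and the shifted point is interior because \<open>R\<close> is an
  upper set.\<close>

text \<open>The open box with opposite corners \<open>b\<close> and \<open>b + 2 *\<^sub>R c\<close>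
  is centred at \<open>b + c\<close>, and each of its points dominates \<open>b\<close>, so it stays
  inside the upper set.\<close>

lemma upper_set_add_pos_interior:
  assumes "upper_set B" "b \<in> B" "\<And>i. 0 < c $ i"
  shows "b + c \<in> interior B"
proof (rule interiorI)
  show "open (box b (b + 2 *\<^sub>R c))"
    by (rule open_box)
  show "b + c \<in> box b (b + 2 *\<^sub>R c)"
    using assms(3) by (simp add: mem_box_cart)
  show "box b (b + 2 *\<^sub>R c) \<subseteq> B"
  proof
    fix y assume "y \<in> box b (b + 2 *\<^sub>R c)"
    then have "0 \<le> y - b"
      by (auto simp: mem_box_cart less_eq_vec_def intro: less_imp_le)
    then have "b + (y - b) \<in> {b + x | b x. b \<in> B \<and> 0 \<le> x}"
      using assms(2) by blast
    then show "y \<in> B"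
      using assms(1) unfolding upper_set_def by simp
  qed
qed

lemma interior_inner_less:
  fixes w :: "'a::real_inner"
  assumes "k \<in> interior B" "w \<noteq> 0"
  obtains y where "y \<in> B" "w \<bullet> y < w \<bullet> k"
proof -
  obtain e where e: "e > 0" "ball k e \<subseteq> B"
    using assms(1) by (auto simp: mem_interior)
  \<comment> \<open>A step of length \<open>e / 2\<close> against the gradient \<open>w\<close>: it
    stays in the ball and lowers the inner product.\<close>
  define y where "y = k - (e / (2 * norm w)) *\<^sub>R w"
  have "dist k y < e"
    using e(1) assms(2) by (simp add: y_def dist_norm)
  then have "y \<in> B"
    using e(2) by auto
  moreover have "w \<bullet> y < w \<bullet> k"
    using e(1) assms(2) by (simp add: y_def inner_diff_right)
  ultimately show thesis
    by (rule that)
qed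

lemma is_arg_min_inner_upper_set_iff:
  fixes w :: "real^'d"
  assumes "closed B" "upper_set B" "\<And>i. w $ i > 0"
  shows "is_arg_min (\<lambda>k. w \<bullet> k) (\<lambda>k. k \<in> B) k \<longleftrightarrow>
    k \<in> frontier B \<and> (\<forall>x\<in>perp w. k + x \<notin> interior B)"
proof
  assume *: "is_arg_min (\<lambda>k. w \<bullet> k) (\<lambda>k. k \<in> B) k"
  have "w \<noteq> 0"
    using assms(3)[of undefined] by auto
  have "k + x \<notin> interior B" if "x \<in> perp w" for x
  proof
    assume "k + x \<in> interior B"
    then obtain y where "y \<in> B" "w \<bullet> y < w \<bullet> (k + x)"
      using \<open>w \<noteq> 0\<close> by (rule interior_inner_less)
    then show False
      using * that by (simp add: is_arg_min_def perp_def inner_add_right)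
  qed
  \<comment> \<open>The shift \<open>0\<close> lies in \<open>perp w\<close>, so the minimiser
    \<open>k\<close> itself is a non-interior point of \<open>B\<close>.\<close>
  moreover from this[of 0] have "k \<in> frontier B"
    using * assms(1) by (simp add: is_arg_min_def perp_def frontier_def)
  ultimately show "k \<in> frontier B \<and> (\<forall>x\<in>perp w. k + x \<notin> interior B)"
    by blast
next
  assume *: "k \<in> frontier B \<and> (\<forall>x\<in>perp w. k + x \<notin> interior B)"
  have "\<not> w \<bullet> k' < w \<bullet> k" if "k' \<in> B" for k'
  proof
    assume less: "w \<bullet> k' < w \<bullet> k"
    have w1: "0 < w \<bullet> 1"
      using assms(3) by (simp add: inner_vec_def sum_pos)
    \<comment> \<open>The solution of
      \<open>w \<bullet> (k' + t *\<^sub>R 1) = w \<bullet> k\<close>; it is positive because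
      \<open>k'\<close> is strictly cheaper than \<open>k\<close>.\<close>
    define t where "t = (w \<bullet> k - w \<bullet> k') / (w \<bullet> 1)"
    have "0 < t"
      using less w1 by (simp add: t_def)
    then have "k' + t *\<^sub>R 1 \<in> interior B"
      using upper_set_add_pos_interior[OF assms(2) that, of "t *\<^sub>R 1"] by simp
    moreover have "k' + t *\<^sub>R 1 - k \<in> perp w"
      using w1 by (simp add: perp_def t_def inner_add_right inner_diff_right)
    ultimately show False
      using * by force
  qed
  moreover have "k \<in> B"
    using * assms(1) frontier_subset_closed by blast
  ultimately show "is_arg_min (\<lambda>k. w \<bullet> k) (\<lambda>k. k \<in> B) k"
    by (simp add: is_arg_min_def)
qed

lemma expected_pointwise_V_EAR:
  "x \<in> perp w \<Longrightarrow> expected_pointwise (V_EAR w V) k F x = expected V (k + x) F"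
  by (simp add: expected_pointwise_def expected_def V_EAR_def)

theorem proposition3p6:
  fixes M :: "'w measure"
    and \<Y>d :: "('w \<Rightarrow> real^'d) set"
    and \<Y> :: "('w \<Rightarrow> real) set"
    and \<Lambda> :: "real^'d \<Rightarrow> real"
    and \<rho> :: "('w \<Rightarrow> real) \<Rightarrow> real"
    and V_R0 :: "real^'d \<Rightarrow> real^'d \<Rightarrow> real"
    and w :: "real^'d"
  assumes setting: "systemic_risk M \<Y>d \<Y> \<Lambda> \<rho>"
    and R_closed: "\<And>Y. Y \<in> \<Y>d \<Longrightarrow> closed (R \<rho> \<Lambda> Y)"
    and R_upper: "\<And>Y. Y \<in> \<Y>d \<Longrightarrow> upper_set (R \<rho> \<Lambda> Y)"
    and R0_boundary: "\<And>Y. Y \<in> \<Y>d \<Longrightarrow> R0 \<rho> \<Lambda> Y = frontier (R \<rho> \<Lambda> Y)"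
    and V_R0: "oriented_strict_selective_identification (law M ` \<Y>d)
                 (on_laws M \<Y>d (R \<rho> \<Lambda>)) (on_laws M \<Y>d (R0 \<rho> \<Lambda>)) V_R0"
    and w_pos: "\<And>i. w $ i > 0"
  shows "\<forall>F\<in>law M ` \<Y>d. \<forall>k.
           k \<in> on_laws M \<Y>d (EAR \<rho> \<Lambda> w) F \<longleftrightarrow>
           ((\<forall>x\<in>perp w. expected_pointwise (V_EAR w V_R0) k F x \<le> 0) \<and>
            expected_pointwise (V_EAR w V_R0) k F 0 = 0)"
proof (intro ballI allI)
  fix F k assume F: "F \<in> law M ` \<Y>d"
  \<comment> \<open>With the very representative that \<open>on_laws\<close> selects, every
    functional on laws, \<open>EAR\<close> included, evaluates at this one \<open>Y\<close>.\<close>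
  define Y where "Y = (SOME Y. Y \<in> \<Y>d \<and> law M Y = F)"
  have "\<exists>Y. Y \<in> \<Y>d \<and> law M Y = F"
    using F by blast
  then have "Y \<in> \<Y>d \<and> law M Y = F"
    unfolding Y_def by (rule someI_ex)
  then have Y: "Y \<in> \<Y>d" ..
  have on_laws: "on_laws M \<Y>d T F = T Y" for T :: "('w \<Rightarrow> real^'d) \<Rightarrow> (real^'d) set"
    by (simp add: on_laws_def Y_def)
  let ?R = "R \<rho> \<Lambda> Y" and ?v = "\<lambda>k. expected V_R0 k F"
  have zero: "?v l = 0 \<longleftrightarrow> l \<in> frontier ?R"
    and neg: "l \<notin> ?R \<Longrightarrow> ?v l < 0"
    and pos: "l \<in> ?R - frontier ?R \<Longrightarrow> 0 < ?v l" for l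
    using V_R0[unfolded oriented_strict_selective_identification_def
        strict_selective_identification_def] F
    by (metis on_laws R0_boundary[OF Y])+
  \<comment> \<open>Points of \<open>?R\<close> are either interior, with positive value, or on the
    frontier, with value zero; outside \<open>?R\<close> the value is negative.\<close>
  have nonpos: "?v l \<le> 0 \<longleftrightarrow> l \<notin> interior ?R" for l
  proof (cases "l \<in> ?R")
    case True
    then show ?thesis
      using zero[of l] pos[of l] closure_subset[of ?R]
      by (auto simp: frontier_def)
  next
    case False
    then show ?thesis
      using neg[of l] interior_subset[of ?R] by auto
  qed
  \<comment> \<open>\<open>V_EAR\<close> is \<open>undefined\<close> off \<open>perp w\<close>, so
    its value at \<open>0\<close> can be rewritten only after this check.\<close>
  have "0 \<in> perp w"
    by (simp add: perp_def)
  then show "k \<in> on_laws M \<Y>d (EAR \<rho> \<Lambda> w) F \<longleftrightarrow>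
      ((\<forall>x\<in>perp w. expected_pointwise (V_EAR w V_R0) k F x \<le> 0) \<and>
       expected_pointwise (V_EAR w V_R0) k F 0 = 0)"
    using is_arg_min_inner_upper_set_iff[OF R_closed[OF Y] R_upper[OF Y] w_pos, of k]
    by (auto simp: on_laws EAR_def expected_pointwise_V_EAR zero nonpos)
qed

end
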